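(* Any pair of isometries of the Euclidean plane admits a head to tail composition. That is, for any isometries $S$ and $T$ of the Euclidean plane $\mathbb{R}^2$ there exist flippers $A$, $B$, $C$ in $\mathbb{R}^2$ such that $S=F_B\circ F_A$ and $T=F_C\circ F_B$; in other words, $S$ and $T$ are presented by biflippers $\overrightarrow{AB}$ and $\overrightarrow{BC}$, respectively.
   Context: A flipper in the Euclidean plane $\mathbb{R}^2$ is a non-empty affine subspace $A$ of $\mathbb{R}^2$ (a point, a line, or the whole plane). The flip $F_A$ is the unique isometry $F_A:\mathbb{R}^2\to\mathbb{R}^2$ with $F_A\circ F_A=\mathrm{id}$ whose fixed point set is $A$: it is the central symmetry in $A$ if $A$ is a point, the reflection in $A$ if $A$ is a line, and the identity if $A=\mathbb{R}^2$. A biflipper $\overrightarrow{AB}$ is an ordered pair $(A,B)$ of flippers; it presents (encodes) the isometry $F_B\circ F_A$ (first $F_A$, then $F_B$). Isometries are not required to preserve orientation. *)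

theory Defs
  imports "HOL-Analysis.Analysis"
begin

(* Surjectivity is not required: in a Euclidean space it follows from preservation of distances. *)
definition isometry :: "('a::euclidean_space \<Rightarrow> 'a) \<Rightarrow> bool" where
  "isometry F \<longleftrightarrow> (\<forall>x y. dist (F x) (F y) = dist x y)"

definition flipper :: "'a::euclidean_space set \<Rightarrow> bool" where
  "flipper A \<longleftrightarrow> affine A \<and> A \<noteq> {}"

definition is_flip :: "'a::euclidean_space set \<Rightarrow> ('a \<Rightarrow> 'a) \<Rightarrow> bool" where
  "is_flip A F \<longleftrightarrow> isometry F \<and> F \<circ> F = id \<and> {x. F x = x} = A"

(* The description is proper for every flipper A; see is_flip_flip below. *)
definition flip :: "'a::euclidean_space set \<Rightarrow> 'a \<Rightarrow> 'a" where
  "flip A = (THE F. is_flip A F)"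

lemma dist_eq_iff_inner_midpoint:
  fixes x y a :: "'a::euclidean_space"
  assumes "dist a x = dist a y"
  shows "(x - midpoint x y) \<bullet> (a - midpoint x y) = 0"
proof -
  have "(a - x) \<bullet> (a - x) = (a - y) \<bullet> (a - y)"
    using assms by (simp add: dist_norm norm_eq)
  then show ?thesis
    by (simp add: midpoint_def inner_simps inner_commute algebra_simps)
qed

lemma affine_closest_point_inner:
  fixes A :: "'a::euclidean_space set"
  assumes "flipper A" "a \<in> A"
  shows "closest_point A x \<in> A"
    and "(x - closest_point A x) \<bullet> (a - closest_point A x) = 0"
proof -
  let ?p = "closest_point A x"
  have A: "affine A" "A \<noteq> {}" "closed A" "convex A"
    using assms by (auto simp: flipper_def affine_closed affine_imp_convex)
  show p: "?p \<in> A"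
    using A by (simp add: closest_point_in_set)
  have "2 *\<^sub>R ?p + (-1) *\<^sub>R a \<in> A"
    using A(1) p assms(2) unfolding affine_def by (metis add.commute uminus_add_conv_diff diff_minus_eq_add one_add_one add_diff_cancel)
  then have "(x - ?p) \<bullet> ((2 *\<^sub>R ?p + (-1) *\<^sub>R a) - ?p) \<le> 0"
    using A closest_point_dot by blast
  moreover have "(2 *\<^sub>R ?p + (-1) *\<^sub>R a) - ?p = - (a - ?p)"
    by (simp add: scaleR_2)
  moreover have "(x - ?p) \<bullet> (a - ?p) \<le> 0"
    using A assms(2) closest_point_dot by blast
  ultimately show "(x - ?p) \<bullet> (a - ?p) = 0"
    by (simp only: inner_minus_right)
qed

lemma orthogonal_foot_unique:
  fixes p q x :: "'a::euclidean_space"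
  assumes "(x - p) \<bullet> (q - p) = 0" "(x - q) \<bullet> (p - q) = 0"
  shows "p = q"
proof -
  have "(p - q) \<bullet> (p - q) = (x - p) \<bullet> (q - p) + (x - q) \<bullet> (p - q)"
    by (simp add: inner_simps inner_commute algebra_simps)
  then show ?thesis
    using assms by simp
qed

lemma is_flip_unique:
  fixes A :: "'a::euclidean_space set"
  assumes A: "flipper A" and F: "is_flip A F"
  shows "F x = 2 *\<^sub>R closest_point A x - x"
proof -
  let ?m = "midpoint x (F x)"
  have iso: "dist (F u) (F v) = dist u v" for u v
    using F by (simp add: is_flip_def isometry_def)
  have inv: "F (F u) = u" for u
    using F by (metis is_flip_def comp_apply id_apply)
  have fix_iff: "u \<in> A \<longleftrightarrow> F u = u" for u
    using F by (auto simp: is_flip_def)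
  have d: "dist (F ?m) x = dist x (F x) / 2" "dist (F ?m) (F x) = dist x (F x) / 2"
    using iso[of ?m "F x"] iso[of ?m x] by (simp_all add: inv dist_midpoint)
  have "?m = F ?m"
  proof -
    define u where "u = F ?m - x"
    define v where "v = F ?m - F x"
    have n: "norm u = norm v" "norm (v - u) = 2 * norm u"
      using d by (simp_all add: u_def v_def dist_norm norm_minus_commute)
    have "norm (u + v) ^ 2 + norm (v - u) ^ 2 = 2 * norm u ^ 2 + 2 * norm v ^ 2"
      by (simp add: power2_norm_eq_inner inner_simps inner_commute)
    then have "u + v = 0"
      using n by (simp add: power2_eq_square)
    then have "2 *\<^sub>R F ?m = x + F x"
      by (simp add: u_def v_def scaleR_2 algebra_simps)
    then have "(1/2) *\<^sub>R (2 *\<^sub>R F ?m) = (1/2) *\<^sub>R (x + F x)" by simp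
    then show ?thesis by (simp add: midpoint_def)
  qed
  then have m: "?m \<in> A"
    by (simp add: fix_iff)
  have perp: "(x - ?m) \<bullet> (a - ?m) = 0" if "a \<in> A" for a
    using that iso[of a x] by (intro dist_eq_iff_inner_midpoint) (simp add: fix_iff)
  have "closest_point A x = ?m"
    using affine_closest_point_inner[OF A m] perp orthogonal_foot_unique by metis
  then show ?thesis
    by (simp add: midpoint_def)
qed

lemma is_flip_closest_point:
  fixes A :: "'a::euclidean_space set"
  assumes A: "flipper A"
  shows "is_flip A (\<lambda>x. 2 *\<^sub>R closest_point A x - x)"
proof -
  let ?p = "closest_point A"
  have inA: "?p x \<in> A" for x
    using A affine_closest_point_inner(1) by (metis flipper_def ex_in_conv)
  have perp: "(x - ?p x) \<bullet> (?p y - ?p x) = 0" for x y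
    using A inA affine_closest_point_inner(2) by blast
  have "dist (2 *\<^sub>R ?p x - x) (2 *\<^sub>R ?p y - y) = dist x y" for x y
  proof -
    have "(2 *\<^sub>R ?p x - x - (2 *\<^sub>R ?p y - y)) \<bullet> (2 *\<^sub>R ?p x - x - (2 *\<^sub>R ?p y - y))
      = (x - y) \<bullet> (x - y) + 4 * ((x - ?p x) \<bullet> (?p y - ?p x)) + 4 * ((y - ?p y) \<bullet> (?p x - ?p y))"
      by (simp add: inner_simps inner_commute algebra_simps)
    then show ?thesis
      by (simp add: perp dist_norm norm_eq)
  qed
  moreover have "?p (2 *\<^sub>R ?p x - x) = ?p x" for x
  proof -
    let ?y = "2 *\<^sub>R ?p x - x"
    have "(?y - ?p x) \<bullet> (?p ?y - ?p x) = - ((x - ?p x) \<bullet> (?p ?y - ?p x))"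
      by (simp add: inner_simps scaleR_2)
    then show ?thesis
      using perp[of ?y x] perp[of x ?y] orthogonal_foot_unique[of ?y "?p x" "?p ?y"] by simp
  qed
  moreover have "2 *\<^sub>R ?p x - x = x \<longleftrightarrow> x \<in> A" for x
  proof
    assume "2 *\<^sub>R ?p x - x = x"
    then have "2 *\<^sub>R ?p x = 2 *\<^sub>R x" by (simp add: scaleR_2 algebra_simps)
    then show "x \<in> A" using inA[of x] by simp
  next
    assume "x \<in> A"
    then show "2 *\<^sub>R ?p x - x = x" by (simp add: closest_point_self scaleR_2)
  qed
  ultimately show ?thesis
    by (auto simp: is_flip_def isometry_def fun_eq_iff)
qed

lemma is_flip_flip:
  assumes "flipper A"
  shows "is_flip A (flip A)"
  unfolding flip_def
proof (rule theI[where a = "\<lambda>x. 2 *\<^sub>R closest_point A x - x"])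
  show "is_flip A (\<lambda>x. 2 *\<^sub>R closest_point A x - x)"
    using assms by (rule is_flip_closest_point)
next
  fix F assume "is_flip A F"
  then show "F = (\<lambda>x. 2 *\<^sub>R closest_point A x - x)"
    using is_flip_unique[OF assms] by blast
qed

end

theory Submission
  imports Defs
begin

text \<open>
  Suppose \<open>G\<close> is the flip in \<open>B\<close>. Since \<open>G\<close> is an involution, \<open>S\<close> equals \<open>G \<circ> F\<close> for a flip \<open>F\<close>
  exactly when \<open>G \<circ> S\<close> is a flip, and \<open>T\<close> equals \<open>F \<circ> G\<close> for a flip \<open>F\<close> exactly when \<open>T \<circ> G\<close> is
  one. Every isometric involution is a flip, because it is affine and hence fixes the midpoint of
  a point and its image (\<open>isometric_involution_is_flip\<close>). So both requirements say that \<open>G\<close>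
  conjugates the isometry into its inverse, and the theorem asks for one isometric involution
  that reverses \<open>S\<close> and \<open>T\<close> simultaneously.

  In the plane, a non-trivial rotation is reversed by the reflections in the lines through its
  centre. Every other isometry is a translation or a glide reflection, and has an axis \<open>L\<close> such that
  it is reversed by the half-turns about the points of \<open>L\<close> and by the reflections in the lines
  perpendicular to \<open>L\<close> (\<open>central_or_axial\<close>). Two centres lie on a common line; from a centre a
  perpendicular can be dropped to an axis; two axes either meet in a point or have a common
  perpendicular. In each case this yields a common reversing involution
  (\<open>common_reversing_involution\<close>). The computations are carried out in the complex plane.
\<close>

section \<open>Isometric involutions\<close>

lemma isometry_comp: "isometry F \<Longrightarrow> isometry G \<Longrightarrow> isometry (F \<circ> G)"
  by (simp add: isometry_def)

lemma isometry_orthogonal_part: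
  assumes "isometry F"
  shows "orthogonal_transformation (\<lambda>x. F x - F 0)"
  using assms by (auto simp: orthogonal_transformation_isometry isometry_def dist_norm)

lemma isometry_affine_combination:
  assumes "isometry F" "u + v = 1"
  shows "F (u *\<^sub>R x + v *\<^sub>R y) = u *\<^sub>R F x + v *\<^sub>R F y"
proof -
  have lin: "linear (\<lambda>x. F x - F 0)"
    using isometry_orthogonal_part[OF assms(1)] by (simp add: orthogonal_transformation_linear)
  have "F (u *\<^sub>R x + v *\<^sub>R y) - F 0 = u *\<^sub>R (F x - F 0) + v *\<^sub>R (F y - F 0)"
    using linear_add[OF lin] linear_scale[OF lin] by simp
  also have "\<dots> = u *\<^sub>R F x + v *\<^sub>R F y - (u + v) *\<^sub>R F 0"
    by (simp add: algebra_simps)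
  finally show ?thesis
    using assms(2) by simp
qed

text \<open>
  The fixed points form an affine set because an isometry preserves affine combinations; it is
  non-empty because an involution swaps \<open>0\<close> with its image and so fixes their midpoint.
\<close>
lemma isometric_involution_is_flip:
  fixes G :: "'a::euclidean_space \<Rightarrow> 'a"
  assumes iso: "isometry G" and inv: "G \<circ> G = id"
  obtains A where "flipper A" "G = flip A"
proof
  let ?A = "{x. G x = x}"
  have "affine ?A"
    by (auto simp: affine_def isometry_affine_combination[OF iso])
  moreover have "(1/2) *\<^sub>R 0 + (1/2) *\<^sub>R G 0 \<in> ?A"
    using isometry_affine_combination[OF iso, of "1/2" "1/2" 0 "G 0"] fun_cong[OF inv, of 0]
    by simp
  ultimately show A: "flipper ?A"
    unfolding flipper_def by blast
  have "is_flip ?A G"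
    using iso inv by (simp add: is_flip_def)
  then show "G = flip ?A"
    using is_flip_unique[OF A _] is_flip_unique[OF A is_flip_flip[OF A]]
    by (intro ext) (rule trans[OF _ sym])
qed

section \<open>Involutions reversing an isometry\<close>

text \<open>
  For an invertible \<open>S\<close> and an involution \<open>G\<close> this equation says that \<open>G \<circ> S \<circ> G\<close> is inverse
  to \<open>S\<close>; written this way it is visibly symmetric, giving both \<open>G \<circ> S\<close> and \<open>S \<circ> G\<close> as involutions.
\<close>
definition reverses :: "('a \<Rightarrow> 'a) \<Rightarrow> ('a \<Rightarrow> 'a) \<Rightarrow> bool" where
  "reverses G S \<longleftrightarrow> S \<circ> G \<circ> S = G"

text \<open>
  Here \<open>G\<close> plays the flip in the shared flipper: it can be split off on either side, so that the
  same \<open>G\<close> may serve as head of one biflipper and as tail of another.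
\<close>
lemma flip_factors_of_reversed:
  fixes S G :: "'a::euclidean_space \<Rightarrow> 'a"
  assumes S: "isometry S" and G: "isometry G" and inv: "G \<circ> G = id" and rev: "reverses G S"
  obtains A C where "flipper A" "S = G \<circ> flip A" "flipper C" "S = flip C \<circ> G"
proof -
  have inv': "G (G x) = x" for x
    using inv by (metis comp_apply id_apply)
  have rev': "S (G (S x)) = G x" for x
    using rev by (metis reverses_def comp_apply)
  have "(G \<circ> S) \<circ> (G \<circ> S) = id" "(S \<circ> G) \<circ> (S \<circ> G) = id"
    by (auto simp: rev' inv')
  then obtain A C where "flipper A" "G \<circ> S = flip A" "flipper C" "S \<circ> G = flip C"
    using isometric_involution_is_flip isometry_comp S G by metis
  moreover have "S = G \<circ> (G \<circ> S)" "S = (S \<circ> G) \<circ> G"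
    by (auto simp: inv')
  ultimately show thesis
    using that by metis
qed

section \<open>Isometries of the complex plane\<close>

text \<open>
  The reflection in the line through \<open>p\<close> with unit direction vector \<open>u\<close>: the conjugation,
  transported from the real direction to \<open>u\<close>, is \<open>u * cnj (w / u)\<close>, which equals \<open>u\<^sup>2 * cnj w\<close>.
\<close>
definition line_reflection :: "complex \<Rightarrow> complex \<Rightarrow> complex \<Rightarrow> complex" where
  "line_reflection p u z = p + u\<^sup>2 * cnj (z - p)"

definition half_turn :: "complex \<Rightarrow> complex \<Rightarrow> complex" where
  "half_turn p z = 2 * p - z"

lemma unit_mult_cnj: "norm u = 1 \<Longrightarrow> u * cnj u = 1"
  by (simp add: complex_norm_square[symmetric])

lemma unit_cancel: "norm u = 1 \<Longrightarrow> z * cnj u * u = z"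
  using unit_mult_cnj[of u] by (metis mult.assoc mult.commute mult.right_neutral)

lemma unit_square_mult_cnj: "norm u = 1 \<Longrightarrow> u\<^sup>2 * cnj u = u"
  using unit_mult_cnj[of u] by (simp add: power2_eq_square mult.assoc)

lemma unit_square_cancel: "norm u = 1 \<Longrightarrow> u\<^sup>2 * (cnj u)\<^sup>2 = 1"
  by (simp add: power_mult_distrib[symmetric] unit_mult_cnj)

lemma unit_direction:
  fixes z :: complex
  obtains u where "norm u = 1" "z = of_real (norm z) * u"
proof (cases "z = 0")
  case True
  then show thesis
    using that[of 1] by simp
next
  case False
  then show thesis
    using that[of "sgn z"] by (simp add: norm_sgn, simp add: sgn_eq)
qed

lemma isometry_line_reflection:
  assumes "norm u = 1"
  shows "isometry (line_reflection p u)"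
proof -
  have "line_reflection p u x - line_reflection p u y = u\<^sup>2 * cnj (x - y)" for x y
    by (simp add: line_reflection_def algebra_simps)
  then show ?thesis
    using assms by (simp add: isometry_def dist_norm norm_mult norm_power del: complex_cnj_diff)
qed

lemma line_reflection_involution:
  assumes "norm u = 1"
  shows "line_reflection p u \<circ> line_reflection p u = id"
proof
  fix z
  have "(line_reflection p u \<circ> line_reflection p u) z = p + (u\<^sup>2 * (cnj u)\<^sup>2) * (z - p)"
    by (simp add: line_reflection_def algebra_simps)
  then show "(line_reflection p u \<circ> line_reflection p u) z = id z"
    by (simp add: unit_square_cancel[OF assms])
qed

lemma isometry_half_turn: "isometry (half_turn p)"
  by (simp add: isometry_def half_turn_def dist_norm norm_minus_commute)

lemma half_turn_involution: "half_turn p \<circ> half_turn p = id"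
  by (auto simp: half_turn_def)

lemma unit_orthogonal_complex:
  assumes "norm a = 1" "norm b = 1" "a \<bullet> b = 0"
  shows "b = \<i> * a \<or> b = - (\<i> * a)"
proof -
  have b: "b = (b * cnj a) * a"
    using unit_cancel[OF assms(1)] by simp
  have "Re (b * cnj a) = 0"
    using assms(3) by (simp add: inner_complex_def algebra_simps)
  moreover have "norm (b * cnj a) = 1"
    using assms by (simp add: norm_mult)
  ultimately have "b * cnj a = \<i> \<or> b * cnj a = - \<i>"
    by (auto simp: complex_eq_iff cmod_def real_sqrt_eq_1_iff power2_eq_1_iff)
  then show ?thesis
    using b by (metis minus_mult_left)
qed

lemma complex_isometry_cases:
  fixes S :: "complex \<Rightarrow> complex"
  assumes "isometry S"
  obtains (direct) a b where "norm a = 1" "\<And>z. S z = a * z + b"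
  | (opposite) a b where "norm a = 1" "\<And>z. S z = a * cnj z + b"
proof -
  define f where "f = (\<lambda>z. S z - S 0)"
  have f: "orthogonal_transformation f"
    unfolding f_def by (rule isometry_orthogonal_part[OF assms])
  then have lin: "linear f"
    by (simp add: orthogonal_transformation_linear)
  have expand: "f z = of_real (Re z) * f 1 + of_real (Im z) * f \<i>" for z
  proof -
    have "z = Re z *\<^sub>R 1 + Im z *\<^sub>R \<i>"
      by (simp add: complex_eq_iff)
    then have "f z = Re z *\<^sub>R f 1 + Im z *\<^sub>R f \<i>"
      using linear_add[OF lin] linear_scale[OF lin] by metis
    then show ?thesis
      by (simp add: scaleR_conv_of_real)
  qed
  have n: "norm (f 1) = 1" "norm (f \<i>) = 1"
    using f by (simp_all add: orthogonal_transformation)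
  have "f 1 \<bullet> f \<i> = 0"
    using f by (simp add: orthogonal_transformation_def inner_complex_def)
  then consider "f \<i> = \<i> * f 1" | "f \<i> = - (\<i> * f 1)"
    using unit_orthogonal_complex n by blast
  then show thesis
  proof cases
    case 1
    have "S z = f 1 * z + S 0" for z
    proof -
      have "f z = f 1 * (of_real (Re z) + \<i> * of_real (Im z))"
        by (simp add: expand[of z] 1 algebra_simps)
      then show ?thesis
        by (simp add: complex_eq[symmetric] f_def algebra_simps)
    qed
    then show thesis
      using direct n(1) by blast
  next
    case 2
    have "S z = f 1 * cnj z + S 0" for z
    proof -
      have "f z = f 1 * (of_real (Re z) - \<i> * of_real (Im z))"
        by (simp add: expand[of z] 2 algebra_simps)
      moreover have "of_real (Re z) - \<i> * of_real (Im z) = cnj z"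
        by (simp add: complex_eq_iff)
      ultimately show ?thesis
        by (simp add: f_def algebra_simps)
    qed
    then show thesis
      using opposite n(1) by blast
  qed
qed

section \<open>Centres and axes\<close>

definition central :: "complex \<Rightarrow> (complex \<Rightarrow> complex) \<Rightarrow> bool" where
  "central p S \<longleftrightarrow> (\<forall>u. norm u = 1 \<longrightarrow> reverses (line_reflection p u) S)"

text \<open>
  The axis is the line through \<open>q\<close> with direction \<open>u\<close>: a point \<open>p\<close> lies on it iff
  \<open>(p - q) * cnj u\<close> is real, and \<open>\<i> * u\<close> is the direction of its perpendiculars.
\<close>
definition axial :: "complex \<Rightarrow> complex \<Rightarrow> (complex \<Rightarrow> complex) \<Rightarrow> bool" where
  "axial q u S \<longleftrightarrow> norm u = 1 \<and>
     (\<forall>p. Im ((p - q) * cnj u) = 0 \<longrightarrow> reverses (half_turn p) S) \<and>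
     (\<forall>p. reverses (line_reflection p (\<i> * u)) S)"

text \<open>
  A reflection in a line through the centre conjugates multiplication by \<open>a\<close> into multiplication
  by \<open>cnj a\<close>, which is the inverse of \<open>a\<close> on the unit circle.
\<close>
lemma rotation_central:
  assumes "norm a = 1"
  shows "central p (\<lambda>z. p + a * (z - p))"
proof -
  have "p + a * (u\<^sup>2 * cnj (a * (z - p))) = p + (a * cnj a) * (u\<^sup>2 * cnj (z - p))" for u z
    by simp
  then show ?thesis
    by (simp add: central_def reverses_def line_reflection_def fun_eq_iff unit_mult_cnj[OF assms]
        del: complex_cnj_mult complex_cnj_diff)
qed

text \<open>
  Every line parallel to the translation can serve as its axis, because every half-turn reverses
  the direction of translation; the line through \<open>0\<close> is an arbitrary choice.
\<close>
lemma translation_axial: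
  assumes "norm u = 1"
  shows "axial 0 u (\<lambda>z. z + of_real t * u)"
proof -
  have u: "u\<^sup>2 * cnj u = u"
    by (rule unit_square_mult_cnj[OF assms])
  have "line_reflection p (\<i> * u) (z + of_real t * u) + of_real t * u
      = line_reflection p (\<i> * u) z" for p z
  proof -
    have "line_reflection p (\<i> * u) (z + of_real t * u) + of_real t * u
        = line_reflection p (\<i> * u) z - of_real t * (u\<^sup>2 * cnj u) + of_real t * u"
      by (simp add: line_reflection_def power_mult_distrib algebra_simps)
    then show ?thesis
      by (simp add: u)
  qed
  then show ?thesis
    using assms by (simp add: axial_def reverses_def half_turn_def fun_eq_iff)
qed

text \<open>
  Half-turns about points of the mirror and reflections in its perpendiculars both preserve the
  mirror and reverse the glide along it.
\<close>
lemma glide_reflection_axial: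
  assumes "norm u = 1"
  shows "axial q u (\<lambda>z. line_reflection q u z + of_real t * u)"
proof -
  note u2 = unit_square_cancel[OF assms] and u3 = unit_square_mult_cnj[OF assms]
  let ?S = "\<lambda>z. line_reflection q u z + of_real t * u"
  have "?S (half_turn p (?S z)) = half_turn p z" if "Im ((p - q) * cnj u) = 0" for p z
  proof -
    define r where "r = Re ((p - q) * cnj u)"
    have "(p - q) * cnj u = of_real r"
      using that by (simp add: complex_eq_iff r_def)
    then have "p - q = of_real r * u"
      using unit_cancel[OF assms] by metis
    then have p: "p = q + of_real r * u"
      by (simp add: algebra_simps)
    have "?S (half_turn p (?S z)) = q + 2 * of_real r * (u\<^sup>2 * cnj u)
        - (u\<^sup>2 * (cnj u)\<^sup>2) * (z - q) - of_real t * (u\<^sup>2 * cnj u) + of_real t * u"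
      by (simp add: p line_reflection_def half_turn_def algebra_simps)
    then show ?thesis
      unfolding u2 u3 by (simp add: p half_turn_def)
  qed
  moreover have "?S (line_reflection p (\<i> * u) (?S z)) = line_reflection p (\<i> * u) z" for p z
  proof -
    have "?S (line_reflection p (\<i> * u) (?S z)) =
        q + u\<^sup>2 * cnj (p - q) - (u\<^sup>2 * (cnj u)\<^sup>2) * (q - p + u\<^sup>2 * cnj (z - q) + of_real t * u)
          + of_real t * u"
      by (simp add: line_reflection_def power_mult_distrib algebra_simps)
    also have "\<dots> = line_reflection p (\<i> * u) z"
      by (simp add: u2 line_reflection_def power_mult_distrib algebra_simps)
    finally show ?thesis .
  qed
  ultimately show ?thesis
    using assms by (simp add: axial_def reverses_def fun_eq_iff)
qed

lemma central_or_axial: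
  fixes S :: "complex \<Rightarrow> complex"
  assumes "isometry S"
  shows "(\<exists>p. central p S) \<or> (\<exists>q u. axial q u S)"
  using assms
proof (cases rule: complex_isometry_cases)
  case (direct a b)
  show ?thesis
  proof (cases "a = 1")
    case True
    obtain u where "norm u = 1" "b = of_real (norm b) * u"
      by (rule unit_direction)
    moreover from this have "S = (\<lambda>z. z + of_real (norm b) * u)"
      using direct True by auto
    ultimately show ?thesis
      using translation_axial by metis
  next
    case False
    define p where "p = b / (1 - a)"
    have "b = p * (1 - a)"
      using False by (simp add: p_def)
    then have "S = (\<lambda>z. p + a * (z - p))"
      using direct by (auto simp: algebra_simps)
    then show ?thesis
      using rotation_central direct(1) by metis
  qed
next
  case (opposite a b)
  \<comment> \<open>The linear part fixes the direction \<open>u\<close>. The component of \<open>b\<close> along \<open>u\<close> is the glide; the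
    component across \<open>u\<close> moves the mirror by half its length.\<close>
  define u where "u = csqrt a"
  have a: "a = u\<^sup>2"
    by (simp add: u_def)
  then have u: "norm u = 1"
    using opposite(1) by (simp add: u_def)
  define c where "c = b * cnj u"
  define q where "q = \<i> * of_real (Im c / 2) * u"
  have "q - u\<^sup>2 * cnj q = \<i> * of_real (Im c / 2) * (u + u * (u * cnj u))"
    by (simp add: q_def power2_eq_square algebra_simps)
  also have "\<dots> = \<i> * of_real (Im c) * u"
    by (simp add: unit_mult_cnj[OF u])
  finally have "q - u\<^sup>2 * cnj q + of_real (Re c) * u = (of_real (Re c) + \<i> * of_real (Im c)) * u"
    by (simp add: algebra_simps)
  also have "\<dots> = b"
    unfolding complex_eq[symmetric] c_def by (rule unit_cancel[OF u])
  finally have "b = q - u\<^sup>2 * cnj q + of_real (Re c) * u" ..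
  then have "S = (\<lambda>z. line_reflection q u z + of_real (Re c) * u)"
    using opposite(2) a by (auto simp: line_reflection_def algebra_simps)
  then show ?thesis
    using glide_reflection_axial[OF u] by metis
qed

section \<open>Common reversing involutions\<close>

lemma common_line_of_centres:
  obtains u where "norm u = 1" "line_reflection p u = line_reflection q u"
proof -
  obtain u where u: "norm u = 1" and "q - p = of_real (norm (q - p)) * u"
    by (rule unit_direction)
  then have "q = p + of_real (norm (q - p)) * u"
    by (metis add.commute diff_add_cancel)
  then obtain r where q: "q = p + of_real r * u"
    by blast
  have "u\<^sup>2 * cnj u = u"
    by (rule unit_square_mult_cnj[OF u])
  then have "line_reflection p u z = line_reflection q u z" for z
    by (simp add: q line_reflection_def algebra_simps)
  then show thesis
    using that u by blast
qed

lemma axes_meet_or_parallel: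
  assumes "norm u = 1" "norm v = 1"
  obtains (meet) p where "Im ((p - q) * cnj u) = 0" "Im ((p - q') * cnj v) = 0"
  | (parallel) "u\<^sup>2 = v\<^sup>2"
proof (cases "Im (u * cnj v) = 0")
  case True
  have "(u * cnj v)\<^sup>2 = of_real ((norm (u * cnj v))\<^sup>2)"
    using True by (simp add: complex_eq_iff cmod_power2)
  then have "u\<^sup>2 * (cnj v)\<^sup>2 = 1"
    using assms by (simp add: power_mult_distrib norm_mult)
  then have "u\<^sup>2 * (cnj v)\<^sup>2 * v\<^sup>2 = v\<^sup>2"
    by simp
  then have "u\<^sup>2 = v\<^sup>2"
    using unit_square_cancel[OF assms(2)] by (simp add: mult.assoc mult.commute[of "(cnj v)\<^sup>2"])
  then show thesis
    by (rule parallel)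
next
  case False
  \<comment> \<open>The numbers \<open>Im (w * cnj v)\<close> measure the component of \<open>w\<close> across \<open>v\<close>; moving from \<open>q\<close> along \<open>u\<close>
    must cover the component of \<open>q' - q\<close>.\<close>
  define r where "r = Im ((q' - q) * cnj v) / Im (u * cnj v)"
  define p where "p = q + of_real r * u"
  have "(p - q) * cnj u = of_real r"
    using unit_mult_cnj[OF assms(1)] by (simp add: p_def mult.assoc)
  then have "Im ((p - q) * cnj u) = 0"
    by simp
  moreover have "(p - q') * cnj v = of_real r * (u * cnj v) - (q' - q) * cnj v"
    by (simp add: p_def algebra_simps)
  then have "Im ((p - q') * cnj v) = r * Im (u * cnj v) - Im ((q' - q) * cnj v)"
    by (simp only: minus_complex.sel Im_complex_of_real Re_complex_of_real times_complex.sel)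
  then have "Im ((p - q') * cnj v) = 0"
    using False by (simp add: r_def)
  ultimately show thesis
    by (rule meet)
qed

lemma common_reversing_involution:
  fixes S T :: "complex \<Rightarrow> complex"
  assumes "isometry S" "isometry T"
  obtains G where "isometry G" "G \<circ> G = id" "reverses G S" "reverses G T"
proof -
  note by_involution = that
  have line: thesis
    if "norm u = 1" "reverses (line_reflection p u) S" "reverses (line_reflection p u) T" for p u
    using that isometry_line_reflection line_reflection_involution by_involution by blast
  have perp: "norm (\<i> * u) = 1" if "norm u = 1" for u
    using that by (simp add: norm_mult)
  consider p q where "central p S" "central q T"
    | p q u where "central p S" "axial q u T"
    | p q u where "axial q u S" "central p T"
    | q u q' v where "axial q u S" "axial q' v T"
    using central_or_axial[OF assms(1)] central_or_axial[OF assms(2)] by metis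
  then show thesis
  proof cases
    case 1
    then show thesis
      using common_line_of_centres[of p q] line unfolding central_def by metis
  next
    case 2
    then show thesis
      using line perp unfolding central_def axial_def by blast
  next
    case 3
    then show thesis
      using line perp unfolding central_def axial_def by blast
  next
    case 4
    then have n: "norm u = 1" "norm v = 1"
      by (auto simp: axial_def)
    then show thesis
    proof (cases rule: axes_meet_or_parallel[of u v q q'])
      case (meet p)
      then show thesis
        using 4 by_involution[of "half_turn p"] isometry_half_turn half_turn_involution
        unfolding axial_def by blast
    next
      case parallel
      then have "line_reflection q (\<i> * u) = line_reflection q (\<i> * v)"
        by (simp add: line_reflection_def fun_eq_iff power_mult_distrib)
      then show thesis
        using 4 line[of "\<i> * u" q] perp n unfolding axial_def by metis
    qed
  qed
qed

section \<open>Head to tail composition\<close>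

definition plane_to_complex :: "real ^ 2 \<Rightarrow> complex" where
  "plane_to_complex x = Complex (x $ 1) (x $ 2)"

definition complex_to_plane :: "complex \<Rightarrow> real ^ 2" where
  "complex_to_plane z = vector [Re z, Im z]"

lemma complex_to_plane_to_complex [simp]: "plane_to_complex (complex_to_plane z) = z"
  by (simp add: plane_to_complex_def complex_to_plane_def)

lemma plane_to_complex_to_plane [simp]: "complex_to_plane (plane_to_complex x) = x"
  by (simp add: plane_to_complex_def complex_to_plane_def vec_eq_iff forall_2)

lemma dist_plane_to_complex [simp]: "dist (plane_to_complex x) (plane_to_complex y) = dist x y"
  by (simp add: plane_to_complex_def dist_norm norm_vec_def L2_set_def sum_2 cmod_def)

lemma dist_complex_to_plane [simp]: "dist (complex_to_plane w) (complex_to_plane z) = dist w z"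
  by (metis complex_to_plane_to_complex dist_plane_to_complex)

theorem theorem4:
  fixes S T :: "real ^ 2 \<Rightarrow> real ^ 2"
  assumes "isometry S" and "isometry T"
  shows "\<exists>A B C :: (real ^ 2) set. flipper A \<and> flipper B \<and> flipper C \<and>
           S = flip B \<circ> flip A \<and> T = flip C \<circ> flip B"
proof -
  let ?c = plane_to_complex and ?d = complex_to_plane
  have "isometry (?c \<circ> S \<circ> ?d)" "isometry (?c \<circ> T \<circ> ?d)"
    using assms by (simp_all add: isometry_def)
  then obtain H where H: "isometry H" "H \<circ> H = id"
    "reverses H (?c \<circ> S \<circ> ?d)" "reverses H (?c \<circ> T \<circ> ?d)"
    using common_reversing_involution by blast
  define G where "G = ?d \<circ> H \<circ> ?c"
  have pull_back: "reverses G R" if "reverses H (?c \<circ> R \<circ> ?d)" for R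
  proof -
    have "?c (R (?d (H (?c (R x))))) = H (?c x)" for x
      using fun_cong[OF that[unfolded reverses_def], of "?c x"] by simp
    then have "R (G (R x)) = G x" for x
      unfolding G_def comp_apply by (metis plane_to_complex_to_plane)
    then show ?thesis
      by (auto simp: reverses_def)
  qed
  have G: "isometry G" "G \<circ> G = id"
    using H(1,2) by (simp_all add: isometry_def G_def fun_eq_iff)
  obtain A where "flipper A" "S = G \<circ> flip A"
    using flip_factors_of_reversed[OF assms(1) G pull_back[OF H(3)]] by metis
  moreover obtain C where "flipper C" "T = flip C \<circ> G"
    using flip_factors_of_reversed[OF assms(2) G pull_back[OF H(4)]] by metis
  moreover obtain B where "flipper B" "G = flip B"
    using isometric_involution_is_flip[OF G] by metis
  ultimately show ?thesis
    by blast
qed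

end
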